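(* Let $n\ge 2$, let $d$ be an integer with $1\le d\le \frac{n}{2}$, and let $j_1\neq j_2$ be elements of $\{1,\dots,n\}$. Then the characteristic polynomial of $A=C_n+T(1,j_1,d+1,j_2)$ is $$p(x)=x^n-x^{n-j_1}+x^{[n-j_1+d]}+x^{n-j_2}-x^{[n-j_2+d]}-1,$$ where for an integer $t$, $[t]$ denotes the remainder on dividing $t$ by $n$.
   Context: $C_n$ is the companion matrix of $x^n-1$: the $n\times n$ matrix with $1$ in positions $(i+1,i)$ for $1\le i\le n-1$, $1$ in position $(1,n)$, and $0$ elsewhere. $T(i_1,j_1,i_2,j_2)$ (with $i_1\ne i_2$, $j_1\ne j_2$) is the $n\times n$ matrix with $1$ in positions $(i_1,j_1),(i_2,j_2)$, $-1$ in positions $(i_1,j_2),(i_2,j_1)$, and $0$ elsewhere. *)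

theory Defs
  imports "Jordan_Normal_Form.Char_Poly" Complex_Main
begin

(* Library matrices are indexed from 0, the mathematical positions (i, j) from 1:
   the (i, j) entry of "mat_of_pos n f" is f i j for i, j in {1..n}. *)
definition mat_of_pos :: "nat \<Rightarrow> (nat \<Rightarrow> nat \<Rightarrow> 'a) \<Rightarrow> 'a mat" where
  "mat_of_pos n f = mat n n (\<lambda>(r, c). f (Suc r) (Suc c))"

(* the companion matrix of x^n - 1 *)
definition C_mat :: "nat \<Rightarrow> 'a :: comm_ring_1 mat" where
  "C_mat n = mat_of_pos n (\<lambda>i j.
     if (j \<in> {1..n - 1} \<and> i = j + 1) \<or> (i = 1 \<and> j = n) then 1 else 0)"

(* Intended for i1 \<noteq> i2 and j1 \<noteq> j2, where the four positions are distinct. *)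
definition T_mat :: "nat \<Rightarrow> nat \<Rightarrow> nat \<Rightarrow> nat \<Rightarrow> nat \<Rightarrow> 'a :: comm_ring_1 mat" where
  "T_mat n i1 j1 i2 j2 = mat_of_pos n (\<lambda>i j.
     if (i, j) \<in> {(i1, j1), (i2, j2)} then 1
     else if (i, j) \<in> {(i1, j2), (i2, j1)} then - 1
     else 0)"

(* [t] for an integer t, as a natural number so that it can serve as an exponent *)
definition rem_of :: "nat \<Rightarrow> int \<Rightarrow> nat" where
  "rem_of n t = nat (t mod int n)"

end

(* With M = x - C one has x - A = M + (e_1 - e_{d+1}) v^T, where v = e_{j2} - e_{j1}.  By the matrix
   determinant lemma, det(M + u v^T) = det M + v^T adj(M) u, it is enough to know
   adj(M) (e_1 - e_{d+1}), that is, the solution b of M b = (x^n - 1) (e_1 - e_{d+1}); since C is a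
   cyclic shift, the entries of b are differences of powers of x whose exponents shift cyclically.
   The coefficient ring may have zero divisors, but det M = x^n - 1 is monic and can be cancelled. *)
theory Submission
  imports Defs
begin

text \<open>A monic factor preserves leading coefficients even in the presence of zero divisors: the
  top coefficient of \<open>q * (y - z)\<close> is that of \<open>y - z\<close>, so the product
  vanishes only if \<open>y - z\<close> does.\<close>

lemma monic_mult_left_cancel:
  fixes q y z :: "'a :: comm_ring_1 poly"
  assumes "lead_coeff q = 1" "q * y = q * z"
  shows "y = z"
proof (rule ccontr)
  assume "y \<noteq> z"
  then have "lead_coeff (y - z) \<noteq> 0" by (simp del: coeff_diff)
  moreover have "coeff (q * (y - z)) (degree q + degree (y - z)) = lead_coeff (y - z)"
    using assms(1) by (simp add: coeff_mult_degree_sum del: coeff_diff)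
  moreover have "q * (y - z) = 0" using assms(2) by (simp add: algebra_simps)
  ultimately show False by simp
qed

text \<open>Applying the adjugate to \<open>Mb\<close> shows that \<open>b\<close> and column
  \<open>k\<close> of \<open>adj_mat M\<close> agree up to the factor \<open>det M\<close>, which
  \<open>cancel\<close> removes. That column lists the cofactors along row \<open>k\<close>.\<close>

lemma cofactor_eqI:
  fixes M :: "'a :: comm_ring_1 mat"
  assumes M: "M \<in> carrier_mat n n" and k: "k < n" and j: "j < n"
    and b: "b \<in> carrier_vec n"
    and Mb: "M *\<^sub>v b = det M \<cdot>\<^sub>v unit_vec n k"
    and cancel: "\<And>y z. det M * y = det M * z \<Longrightarrow> y = z"
  shows "cofactor M k j = b $ j"
proof -
  note adj = adj_mat[OF M]
  have "det M \<cdot>\<^sub>v b = (det M \<cdot>\<^sub>m 1\<^sub>m n) *\<^sub>v b"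
    using b by (intro eq_vecI) auto
  also have "\<dots> = adj_mat M *\<^sub>v (M *\<^sub>v b)"
    using assoc_mult_mat_vec[OF adj(1) M b] adj(3) by simp
  also have "\<dots> = det M \<cdot>\<^sub>v col (adj_mat M) k"
    unfolding Mb using adj(1) k by (intro eq_vecI) auto
  finally have "det M * b $ j = det M * adj_mat M $$ (j, k)"
    using b j k adj(1) by (metis (no_types, lifting) carrier_matD(1) carrier_vecD col_dim
        index_col carrier_matD(2) index_smult_vec(1))
  then have "b $ j = adj_mat M $$ (j, k)" by (rule cancel)
  then show ?thesis using M k j by (simp add: adj_mat_def)
qed

lemma det_add_row_difference:
  fixes M :: "'a :: comm_ring_1 mat"
  assumes M: "M \<in> carrier_mat n n" and kl: "k < n" "l < n" "k \<noteq> l"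
    and b: "b \<in> carrier_vec n"
    and Mb: "M *\<^sub>v b = det M \<cdot>\<^sub>v (unit_vec n k - unit_vec n l)"
    and cancel: "\<And>y z. det M * y = det M * z \<Longrightarrow> y = z"
    and N: "N \<in> carrier_mat n n"
    and N_row: "\<And>i j. i < n \<Longrightarrow> j < n \<Longrightarrow>
      N $$ (i, j) = M $$ (i, j) + (if i = k then v j else if i = l then - v j else 0)"
  shows "det N = det M + (\<Sum>j<n. v j * b $ j)"
proof -
  \<comment> \<open>Adding row \<open>k\<close> to row \<open>l\<close> removes the perturbation from row \<open>l\<close>, so that expanding along
    row \<open>k\<close> involves cofactors of the unperturbed matrix only.\<close>
  define M' where "M' = addrow 1 l k M"
  define N' where "N' = addrow 1 l k N"
  have M': "M' \<in> carrier_mat n n" and N': "N' \<in> carrier_mat n n"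
    using M N by (auto simp: M'_def N'_def)
  have detM': "det M' = det M" and detN': "det N' = det N"
    unfolding M'_def N'_def using kl M N by (auto intro!: det_addrow)
  have "M' *\<^sub>v b = addrow_mat n 1 l k *\<^sub>v (M *\<^sub>v b)"
    unfolding M'_def addrow_mat[OF M kl(1)]
    using M b by (intro assoc_mult_mat_vec) auto
  have row: "row M' i = (if i = l then row M k + row M l else row M i)" if "i < n" for i
    using that M kl by (intro eq_vecI) (auto simp: M'_def)
  have Mbi: "row M i \<bullet> b = det M * ((if i = k then 1 else 0) - (if i = l then 1 else 0))"
    if "i < n" for i
    using arg_cong[OF Mb, of "\<lambda>w. w $ i"] that M kl by auto
  \<comment> \<open>In row \<open>l\<close> of \<open>M'\<close> the contributions
    \<open>det M\<close> from row \<open>k\<close> and \<open>- det M\<close> from row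
    \<open>l\<close> cancel, so the same \<open>b\<close> yields the cofactors along row
    \<open>k\<close> of \<open>M'\<close>.\<close>
  have "M' *\<^sub>v b = det M' \<cdot>\<^sub>v unit_vec n k"
  proof (rule eq_vecI)
    fix i assume "i < dim_vec (det M' \<cdot>\<^sub>v unit_vec n k)"
    then have i: "i < n" by simp
    have "(M' *\<^sub>v b) $ i = row M' i \<bullet> b" using i M' by simp
    also have "\<dots> = (if i = l then row M k \<bullet> b + row M l \<bullet> b else row M i \<bullet> b)"
      using row[OF i] kl M b by (auto intro!: add_scalar_prod_distrib[of _ n])
    also have "\<dots> = (det M' \<cdot>\<^sub>v unit_vec n k) $ i"
      using Mbi kl i by (auto simp: detM')
    finally show "(M' *\<^sub>v b) $ i = (det M' \<cdot>\<^sub>v unit_vec n k) $ i" .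
  qed (use M' in auto)
  then have cofM': "cofactor M' k j = b $ j" if "j < n" for j
    using cofactor_eqI[OF M' kl(1) that b] cancel detM' by simp
  have "mat_delete N' k j = mat_delete M' k j" if "j < n" for j
    using M' N' M N kl that
    by (intro eq_matI) (auto simp: mat_delete_def M'_def N'_def N_row)
  then have cofN': "cofactor N' k j = b $ j" if "j < n" for j
    using cofM' that by (simp add: cofactor_def)
  have "det N' = (\<Sum>j<n. N' $$ (k, j) * cofactor N' k j)"
    by (rule laplace_expansion_row[OF N' kl(1)])
  also have "\<dots> = (\<Sum>j<n. M' $$ (k, j) * cofactor M' k j + v j * b $ j)"
  proof (rule sum.cong)
    fix j assume "j \<in> {..<n}"
    moreover from this have "N' $$ (k, j) = M' $$ (k, j) + v j"
      using M N kl by (simp add: M'_def N'_def N_row)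
    ultimately show "N' $$ (k, j) * cofactor N' k j =
        M' $$ (k, j) * cofactor M' k j + v j * b $ j"
      by (simp add: cofN' cofM' distrib_right)
  qed simp
  also have "\<dots> = det M' + (\<Sum>j<n. v j * b $ j)"
    by (simp add: sum.distrib laplace_expansion_row[OF M' kl(1)])
  finally show ?thesis by (simp add: detM' detN')
qed

lemma C_mat_carrier [simp]: "C_mat n \<in> carrier_mat n n"
  and T_mat_carrier [simp]: "T_mat n i1 j1 i2 j2 \<in> carrier_mat n n"
  by (simp_all add: C_mat_def T_mat_def mat_of_pos_def)

text \<open>The remainder merges the subdiagonal and the corner entry into a single case, a cyclic
  shift of the basis vectors.\<close>

lemma index_C_mat:
  assumes "i < n" "j < n"
  shows "C_mat n $$ (i, j) = (if i = Suc j mod n then 1 else 0)"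
  using assms by (cases "Suc j = n") (auto simp: C_mat_def mat_of_pos_def)

lemma index_char_poly_matrix:
  assumes "A \<in> carrier_mat n n" "i < n" "j < n"
  shows "char_poly_matrix A $$ (i, j) = (if i = j then monom 1 1 else 0) - [:A $$ (i, j):]"
  using assms by (auto simp: char_poly_matrix_def monom_Suc x_as_monom)

lemma index_char_poly_matrix_C_mat:
  assumes "i < n" "j < n"
  shows "char_poly_matrix (C_mat n :: 'a :: comm_ring_1 mat) $$ (i, j) =
    (if i = j then monom 1 1 else 0) - (if i = Suc j mod n then 1 else 0)"
  using assms by (simp add: index_char_poly_matrix[of _ n] index_C_mat one_pCons)

text \<open>Expansion along row 0, whose nonzero entries x and -1 sit in the first and last columns,
  distinct as \<open>n \<ge> 2\<close>. Both minors are triangular, with x and -1 respectively on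
  the diagonal.\<close>

lemma char_poly_C_mat:
  assumes "n \<ge> 2"
  shows "char_poly (C_mat n :: 'a :: comm_ring_1 mat) = monom 1 n - 1"
proof -
  let ?M = "char_poly_matrix (C_mat n :: 'a mat)"
  define m where "m = n - 1"
  have n: "n = Suc m" "m \<ge> 1" using assms by (auto simp: m_def)
  have M: "?M \<in> carrier_mat n n" by simp
  note dims = carrier_matD[OF M]
  have m: "m < n" "m \<noteq> 0" using n by auto
  have entry: "?M $$ (0, j) = (if j = 0 then monom 1 1 else if j = m then - 1 else 0)"
    if "j < n" for j
    using that n by (cases "j = m") (auto simp: index_char_poly_matrix_C_mat)
  let ?L = "mat_delete ?M 0 0" and ?U = "mat_delete ?M 0 m"
  have LU: "?L \<in> carrier_mat m m" "?U \<in> carrier_mat m m"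
    using mat_delete_carrier[OF M] n by auto
  have L_entry: "?L $$ (i, j) = (if i = j then monom 1 1 else if i = Suc j then - 1 else 0)"
    if "i < m" "j < m" for i j
    using that n by (cases "Suc j = m") (auto simp: mat_delete_def index_char_poly_matrix_C_mat dims[unfolded n])
  have U_entry: "?U $$ (i, j) = (if i = j then - 1 else if Suc i = j then monom 1 1 else 0)"
    if "i < m" "j < m" for i j
    using that n by (auto simp: mat_delete_def index_char_poly_matrix_C_mat dims[unfolded n])
  have "diag_mat ?L = replicate m (monom 1 1)"
    using LU by (intro nth_equalityI) (auto simp: diag_mat_def L_entry)
  moreover have "det ?L = prod_list (diag_mat ?L)"
    by (rule det_lower_triangular[OF _ LU(1)]) (auto simp: L_entry)
  ultimately have detL: "det ?L = monom 1 m" by (simp add: prod_list_replicate monom_power)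
  have "diag_mat ?U = replicate m (- 1)"
    using LU by (intro nth_equalityI) (auto simp: diag_mat_def U_entry)
  moreover have "det ?U = prod_list (diag_mat ?U)"
    by (rule det_upper_triangular[OF _ LU(2)]) (use LU in \<open>auto simp: upper_triangular_def U_entry\<close>)
  ultimately have detU: "det ?U = (- 1) ^ m" by (simp add: prod_list_replicate)
  have "char_poly (C_mat n :: 'a mat) = (\<Sum>j<n. ?M $$ (0, j) * cofactor ?M 0 j)"
    unfolding char_poly_def using n by (intro laplace_expansion_row[OF M]) auto
  also have "\<dots> = (\<Sum>j\<in>{0, m}. ?M $$ (0, j) * cofactor ?M 0 j)"
    using m by (intro sum.mono_neutral_right) (auto simp: entry)
  \<comment> \<open>The cofactor sign \<open>(- 1) ^ m\<close> cancels against the minor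
    \<open>(- 1) ^ m\<close>, so the corner contributes exactly -1.\<close>
  also have "\<dots> = monom 1 n - 1"
    using m by (simp add: entry cofactor_def detL detU mult_monom n(1)[symmetric] flip: power_add)
  finally show ?thesis .
qed

lemma lead_coeff_monom_minus_1:
  assumes "n > 0"
  shows "lead_coeff (monom 1 n - 1 :: 'a :: comm_ring_1 poly) = 1"
proof -
  have "degree (monom 1 n - 1 :: 'a poly) = n"
    using assms by (intro antisym degree_le le_degree) (auto simp: coeff_1)
  then show ?thesis using assms by (simp add: coeff_1)
qed

text \<open>Multiplication by \<open>x\<close> shifts the exponents \<open>(n - 1 - i + s) mod n\<close> cyclically, except
  for the wrap-around from \<open>n - 1\<close> to \<open>0\<close>, which happens in row \<open>s\<close> only.\<close>
lemma char_poly_matrix_C_mat_mult_vec: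
  fixes s :: nat
  assumes "s < n"
  shows "char_poly_matrix (C_mat n :: 'a :: comm_ring_1 mat) *\<^sub>v
      vec n (\<lambda>i. monom 1 ((n - 1 - i + s) mod n)) = (monom 1 n - 1) \<cdot>\<^sub>v unit_vec n s"
    (is "?M *\<^sub>v ?b = _")
proof (rule eq_vecI)
  fix i assume "i < dim_vec ((monom 1 n - 1) \<cdot>\<^sub>v unit_vec n s :: 'a poly vec)"
  then have i: "i < n" by simp
  \<comment> \<open>Row \<open>i\<close> of the shift has its only 1 in column \<open>p\<close>, the
    cyclic predecessor of \<open>i\<close>.\<close>
  define p where "p = (if i = 0 then n - 1 else i - 1)"
  have p: "p < n" "\<And>j. j < n \<Longrightarrow> i = Suc j mod n \<longleftrightarrow> j = p"
    using i by (auto simp: p_def mod_Suc)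
  define e where "e = (n - 1 - i + s) mod n"
  have e: "e < n" using i by (simp add: e_def)
  have "(n - 1 - p + s) mod n = Suc e mod n"
  proof (cases "i = 0")
    case True
    then have "Suc (n - 1 - i + s) = n + s" using i by simp
    then show ?thesis using True by (simp add: e_def p_def mod_Suc_eq)
  next
    case False
    then have "Suc (n - 1 - i + s) = n - 1 - p + s" using i by (simp add: p_def)
    then show ?thesis by (simp only: e_def mod_Suc_eq)
  qed
  \<comment> \<open>The sum \<open>n - 1 - i + s\<close> is at most 2n - 2. If it reaches
    \<open>n\<close>, reduction leaves at most n - 2, and then \<open>i < s\<close>.\<close>
  moreover have "Suc e = n \<longleftrightarrow> i = s"
  proof (cases "n - 1 - i + s < n")
    case True
    then show ?thesis using i assms by (auto simp: e_def)
  next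
    case False
    then have "e = n - 1 - i + s - n"
      using i assms by (simp add: e_def mod_if)
    then show ?thesis using False i assms by auto
  qed
  ultimately have pe: "(n - 1 - p + s) mod n = (if i = s then 0 else Suc e)"
    using e by (auto simp: mod_Suc)
  have "(?M *\<^sub>v ?b) $ i = (\<Sum>j<n. ?M $$ (i, j) * ?b $ j)"
    using i carrier_matD[OF char_poly_matrix_closed[OF C_mat_carrier[of n, where 'a = 'a]]]
    by (auto simp: scalar_prod_def atLeast0LessThan intro!: sum.cong)
  also have "\<dots> = (\<Sum>j<n. (if j = i then monom 1 1 * ?b $ j else 0) - (if j = p then ?b $ j else 0))"
    using i p by (intro sum.cong) (auto simp: index_char_poly_matrix_C_mat algebra_simps)
  \<comment> \<open>The two exponents agree modulo \<open>n\<close>, so the terms cancel except at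
    the wrap-around, where they are \<open>n\<close> and 0.\<close>
  also have "\<dots> = monom 1 (Suc e) - monom 1 ((n - 1 - p + s) mod n)"
    using i p by (simp add: sum_subtractf mult_monom e_def)
  also have "\<dots> = ((monom 1 n - 1) \<cdot>\<^sub>v unit_vec n s) $ i"
    using i assms pe \<open>Suc e = n \<longleftrightarrow> i = s\<close> by auto
  finally show "(?M *\<^sub>v ?b) $ i = ((monom 1 n - 1) \<cdot>\<^sub>v unit_vec n s) $ i" .
qed (simp add: char_poly_matrix_def C_mat_def mat_of_pos_def)

lemma rem_of_eq_mod:
  assumes "j \<in> {1..n}"
  shows "rem_of n (int n - int j + int d) = (n - j + d) mod n"
proof -
  have "int n - int j + int d = int (n - j + d)" using assms by (simp add: of_nat_diff)
  then show ?thesis unfolding rem_of_def by (metis nat_int zmod_int)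
qed

theorem theorem4p3:
  fixes n d j1 j2 :: nat and A :: "'a :: comm_ring_1 mat"
  assumes "n \<ge> 2"
    and "1 \<le> d" and "real d \<le> real n / 2"
    and "j1 \<in> {1..n}" and "j2 \<in> {1..n}" and "j1 \<noteq> j2"
    and "A = C_mat n + T_mat n 1 j1 (d + 1) j2"
  shows "char_poly A =
      monom 1 n
      - monom 1 (n - j1) + monom 1 (rem_of n (int n - int j1 + int d))
      + monom 1 (n - j2) - monom 1 (rem_of n (int n - int j2 + int d))
      - 1"
proof -
  let ?M = "char_poly_matrix (C_mat n :: 'a mat)"
  define b :: "nat \<Rightarrow> 'a poly vec" where
    "b s = vec n (\<lambda>i. monom 1 ((n - 1 - i + s) mod n))" for s
  \<comment> \<open>The signs are opposite to those in row 1 of T because the characteristic matrix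
    subtracts \<open>A\<close>; \<open>Suc j\<close> is the position counted from 1.\<close>
  define v :: "nat \<Rightarrow> 'a poly" where
    "v j = (if Suc j = j2 then 1 else 0) - (if Suc j = j1 then 1 else 0)" for j
  \<comment> \<open>Thus rows 0 and \<open>d\<close> are distinct rows of the matrix.\<close>
  have d: "d < n" "d \<noteq> 0" using assms(1-3) by linarith+
  have M: "?M \<in> carrier_mat n n" by simp
  have detM: "det ?M = monom 1 n - 1"
    using char_poly_C_mat[OF assms(1)] by (simp add: char_poly_def)
  have bc: "b s \<in> carrier_vec n" for s by (simp add: b_def)
  have "?M *\<^sub>v (b 0 - b d) = ?M *\<^sub>v b 0 - ?M *\<^sub>v b d"
    by (rule mult_minus_distrib_mat_vec[OF M bc bc])
  also have "\<dots> = det ?M \<cdot>\<^sub>v (unit_vec n 0 - unit_vec n d)"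
    using d unfolding b_def detM
    by (subst (1 2) char_poly_matrix_C_mat_mult_vec) (auto intro!: eq_vecI simp: algebra_simps)
  finally have Mb: "?M *\<^sub>v (b 0 - b d) = det ?M \<cdot>\<^sub>v (unit_vec n 0 - unit_vec n d)" .
  have A: "A \<in> carrier_mat n n" using assms(7) by simp
  \<comment> \<open>As \<open>j1 \<noteq> j2\<close>, T is the outer product of a difference of two
    basis vectors with another such difference.\<close>
  have T: "T_mat n (Suc 0) j1 (Suc d) j2 $$ (i, j) =
      (if i = 0 then (if Suc j = j1 then 1 else 0) - (if Suc j = j2 then 1 else 0)
       else if i = d then (if Suc j = j2 then 1 else 0) - (if Suc j = j1 then 1 else 0)
       else (0::'a))"
    if "i < n" "j < n" for i j
    using that d assms(6) by (auto simp: T_mat_def mat_of_pos_def)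
  have "char_poly A = det ?M + (\<Sum>j<n. v j * (b 0 - b d) $ j)"
    unfolding char_poly_def
  proof (rule det_add_row_difference[OF M _ d(1) d(2)[symmetric] _ Mb])
    show "y = z" if "det ?M * y = det ?M * z" for y z
      using monic_mult_left_cancel[OF lead_coeff_monom_minus_1 that[unfolded detM]] assms(1) by simp
    show "char_poly_matrix A $$ (i, j) =
        ?M $$ (i, j) + (if i = 0 then v j else if i = d then - v j else 0)"
      if "i < n" "j < n" for i j
    proof -
      have "A $$ (i, j) = C_mat n $$ (i, j) + T_mat n 1 j1 (d + 1) j2 $$ (i, j)"
        using that unfolding assms(7) by (intro index_add_mat) (simp_all add: T_mat_def mat_of_pos_def)
      then show ?thesis
        using that d by (simp add: index_char_poly_matrix[OF A] index_char_poly_matrix[OF C_mat_carrier]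
            T v_def one_pCons)
    qed
  qed (use bc d A in auto)
  also have "(\<Sum>j<n. v j * (b 0 - b d) $ j) = (b 0 - b d) $ (j2 - 1) - (b 0 - b d) $ (j1 - 1)"
  proof -
    have "v j * (b 0 - b d) $ j =
        (if j = j2 - 1 then (b 0 - b d) $ j else 0) - (if j = j1 - 1 then (b 0 - b d) $ j else 0)" for j
      using assms(4,5) by (auto simp: v_def)
    moreover have "j1 - 1 < n" "j2 - 1 < n" using assms(4,5) by auto
    ultimately show ?thesis by (simp add: sum_subtractf)
  qed
  finally have char_poly_A: "char_poly A =
    det ?M + ((b 0 - b d) $ (j2 - 1) - (b 0 - b d) $ (j1 - 1))" .
  \<comment> \<open>Index \<open>j - 1\<close> turns the exponent into \<open>n - j + s\<close>. For
    \<open>s = 0\<close> it is already below \<open>n\<close> because \<open>j \<ge> 1\<close>, so a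
    remainder survives only for \<open>s = d\<close>.\<close>
  have b_entry: "(b 0 - b d) $ (j - 1) = monom 1 (n - j) - monom 1 (rem_of n (int n - int j + int d))"
    if "j \<in> {1..n}" for j
  proof -
    have "j - 1 < n" "n - 1 - (j - 1) = n - j" "n - j < n" using that by auto
    then show ?thesis by (simp add: b_def rem_of_eq_mod[OF that])
  qed
  show ?thesis
    unfolding char_poly_A detM b_entry[OF assms(4)] b_entry[OF assms(5)]
    by (simp add: algebra_simps)
qed

end
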